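(* Let $b\in\mathbb{C}$, let $a_n(z),b_n(z)$ be the polynomials obtained from Olver's recursion (with $f(z)=z^2$, $\mu=b-1$) and let $a_n^\dagger(z),b_n^\dagger(z)$ be Temme's polynomials, both as defined in the context. Then for every $n=0,1,2,\dots$ we have $a_n=a_n^\dagger$ and $b_n=b_n^\dagger$.
   Context: Olver-type polynomials: for $\mu\in\mathbb{C}$ and $f(z)=z^2$, the polynomials $A_s(\mu,z)$ (even) and $B_s(\mu,z)$ (odd) are uniquely determined by $A_0(\mu,z)=1$, $A_s(\mu,0)=0$ for $s\ge1$, and for $s\ge0$ (writing $A_s(z)=A_s(\mu,z)$, $B_s(z)=B_s(\mu,z)$) $$2B_s(z) = -A_s'(z)+\int_0^z\left(f(t)A_s(t)-\frac{2\mu+1}{t} A_s'(t)\right) dt,$$ $$2A_{s+1}(z) = \frac{2\mu+1}{z} B_s(z)- B_s'(z)+\int f(z)B_s(z)\, dz,$$ where the last integral denotes an antiderivative, its constant being fixed by $A_{s+1}(0)=0$. With $\mu=b-1$, set $a_0(z)=1$ and, for $s\ge0$, $$a_{s+1}(z)=A_{s+1}(-\mu,z)+\frac{2\mu}{z}B_s(-\mu,z),\qquad b_s(z)=B_s(-\mu,z).$$ Temme's polynomials: let $$F(s,z)=e^{z^2\phi(s)}\left(\frac{\frac12 s}{\sinh\frac12 s}\right)^b,\qquad \phi(s)=\frac1s-\frac1{e^s-1}-\frac12,$$ with Maclaurin expansion $F(s,z)=\sum_{k=0}^\infty c_k(z)s^k$ (the $b$-th power being the branch equal to $1$ at $s=0$).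 Put $c_k^{(0)}=c_k$ and, for $k\ge0$, $n\ge0$, $$c_k^{(n+1)}=4\big(z^2c_{k+2}^{(n)}+(1-b+k)c_{k+1}^{(n)}\big).$$ Then $a_n^\dagger=c_0^{(n)}$ and $b_n^\dagger=-2z\,c_1^{(n)}$. *)

theory Defs
  imports "HOL-Complex_Analysis.Complex_Analysis"
begin

section \<open>Olver-type polynomials\<close>

text \<open>The antiderivative vanishing at the origin.\<close>

definition poly_antideriv :: "complex poly \<Rightarrow> complex poly" where
  "poly_antideriv p = (\<Sum>i\<le>degree p. monom (coeff p i / of_nat (Suc i)) (Suc i))"

text \<open>
  Division by the variable is written \<open>p div [:0, 1:]\<close>; in the recursion it is only applied to
  odd polynomials, where it is exact. The factor \<open>monom 1 2\<close> is \<open>f(z) = z\<^sup>2\<close>.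
\<close>

definition olver_B_step :: "complex \<Rightarrow> complex poly \<Rightarrow> complex poly" where
  "olver_B_step \<mu> A = smult (1/2)
     (- pderiv A + poly_antideriv (monom 1 2 * A - smult (2*\<mu> + 1) (pderiv A div [:0, 1:])))"

text \<open>
  The term \<open>(2\<mu>+1) B(z)/z - B'(z)\<close> need not vanish at \<open>0\<close>, so the constant of integration that
  makes the next polynomial vanish at \<open>0\<close> is in general not the one of \<open>poly_antideriv\<close>;
  it is fixed by subtracting the value at \<open>0\<close>.
\<close>

definition olver_A_step :: "complex \<Rightarrow> complex poly \<Rightarrow> complex poly" where
  "olver_A_step \<mu> B = (let P = smult (1/2)
     (smult (2*\<mu> + 1) (B div [:0, 1:]) - pderiv B + poly_antideriv (monom 1 2 * B))
     in P - [:poly P 0:])"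

primrec olver_A :: "complex \<Rightarrow> nat \<Rightarrow> complex poly" where
  "olver_A \<mu> 0 = 1"
| "olver_A \<mu> (Suc s) = olver_A_step \<mu> (olver_B_step \<mu> (olver_A \<mu> s))"

definition olver_B :: "complex \<Rightarrow> nat \<Rightarrow> complex poly" where
  "olver_B \<mu> s = olver_B_step \<mu> (olver_A \<mu> s)"

text \<open>The parameter of the polynomials is \<open>-\<mu>\<close>, with \<open>\<mu> = b - 1\<close>.\<close>

fun olver_a :: "complex \<Rightarrow> nat \<Rightarrow> complex poly" where
  "olver_a b 0 = 1"
| "olver_a b (Suc s) =
     (let \<mu> = b - 1 in olver_A (-\<mu>) (Suc s) + smult (2*\<mu>) (olver_B (-\<mu>) s div [:0, 1:]))"

definition olver_b :: "complex \<Rightarrow> nat \<Rightarrow> complex poly" where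
  "olver_b b s = (let \<mu> = b - 1 in olver_B (-\<mu>) s)"


subsection \<open>The analytic form of the recursion\<close>

text \<open>
  The recursion in terms of integrals of functions. The theorem \<open>olver_recursion_iff\<close> below
  says that it determines the two sequences uniquely.
\<close>

definition olver_recursion ::
    "complex \<Rightarrow> (nat \<Rightarrow> complex poly) \<Rightarrow> (nat \<Rightarrow> complex poly) \<Rightarrow> bool" where
  "olver_recursion \<mu> A B \<longleftrightarrow>
     A 0 = 1 \<and> (\<forall>s\<ge>1. poly (A s) 0 = 0) \<and>
     (\<forall>s z. poly (A s) (-z) = poly (A s) z) \<and> (\<forall>s z. poly (B s) (-z) = - poly (B s) z) \<and>
     (\<forall>s z. \<exists>I. ((\<lambda>t. t\<^sup>2 * poly (A s) t - (2*\<mu> + 1) / t * poly (pderiv (A s)) t)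
                    has_contour_integral I) (linepath 0 z) \<and>
                2 * poly (B s) z = - poly (pderiv (A s)) z + I) \<and>
     (\<forall>s. \<exists>G. (\<forall>z. (G has_field_derivative z\<^sup>2 * poly (B s) z) (at z)) \<and>
              (\<forall>z. z \<noteq> 0 \<longrightarrow> 2 * poly (A (Suc s)) z =
                 (2*\<mu> + 1) / z * poly (B s) z - poly (pderiv (B s)) z + G z))"

lemma pderiv_poly_antideriv: "pderiv (poly_antideriv p) = p"
proof -
  have "pderiv (poly_antideriv p) =
      (\<Sum>i\<le>degree p. pderiv (monom (coeff p i / of_nat (Suc i)) (Suc i)))"
    unfolding poly_antideriv_def using higher_pderiv_sum[of 1] by simp
  also have "\<dots> = (\<Sum>i\<le>degree p. monom (coeff p i) i)"
    by (intro sum.cong) (auto simp: pderiv_monom simp del: of_nat_Suc)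
  finally show ?thesis by (simp add: poly_as_sum_of_monoms)
qed

lemma poly_antideriv_0: "poly (poly_antideriv p) 0 = 0"
  by (simp add: poly_antideriv_def poly_sum poly_monom)

lemma poly_div_X:
  fixes p :: "complex poly"
  assumes "poly p 0 = 0"
  shows "poly p z = z * poly (p div [:0, 1:]) z"
proof -
  have "[:0, 1:] dvd p" using assms by (simp add: dvd_iff_poly_eq_0)
  then have "p = [:0, 1:] * (p div [:0, 1:])" by (rule dvd_mult_div_cancel[symmetric])
  then have "poly p z = poly ([:0, 1:] * (p div [:0, 1:])) z" by simp
  then show ?thesis by simp
qed

lemma poly_reflect:
  fixes p q :: "complex poly"
  shows "(\<forall>z. poly p (-z) = poly q z) \<longleftrightarrow> pcompose p [:0, -1:] = q"
  by (auto simp: poly_eq_poly_eq_iff[symmetric] poly_pcompose fun_eq_iff)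

lemma pderiv_reflect:
  fixes p :: "complex poly"
  assumes "\<And>z. poly p (-z) = c * poly p z"
  shows "poly (pderiv p) (-z) = - c * poly (pderiv p) z"
proof -
  have "pcompose p [:0, -1:] = smult c p" using assms poly_reflect[of p "smult c p"] by simp
  then have "pderiv (pcompose p [:0, -1:]) = smult c (pderiv p)" by (simp add: pderiv_smult)
  then have "poly (pcompose (pderiv p) [:0, -1:] * [:-1:]) z = c * poly (pderiv p) z"
    by (simp add: pderiv_pcompose pderiv_pCons)
  then show ?thesis by (simp add: poly_pcompose)
      (metis minus_equation_iff)
qed

lemma antideriv_reflect:
  fixes p :: "complex poly"
  assumes "\<And>z. poly p (-z) = c * poly p z"
  shows "poly (poly_antideriv p) (-z) = - c * poly (poly_antideriv p) z"
proof -
  define q where "q = pcompose (poly_antideriv p) [:0, -1:] + smult c (poly_antideriv p)"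
  have "pcompose p [:0, -1:] = smult c p" using assms poly_reflect[of p "smult c p"] by simp
  then have "pderiv q = 0"
    by (simp add: q_def pderiv_add pderiv_smult pderiv_pcompose pderiv_poly_antideriv pderiv_pCons)
  then obtain k where k: "q = [:k:]" using pderiv_iszero by blast
  have "poly q 0 = 0" by (simp add: q_def poly_pcompose poly_antideriv_0)
  then have "q = 0" using k by simp
  then have "poly q z = 0" by simp
  then show ?thesis by (simp add: q_def poly_pcompose add_eq_0_iff2)
qed

lemma div_X_reflect:
  fixes p :: "complex poly"
  assumes "\<And>z. poly p (-z) = - poly p z"
  shows "poly (p div [:0, 1:]) (-z) = poly (p div [:0, 1:]) z"
proof -
  have p0: "poly p 0 = 0" using assms[of 0] by simp
  define q where "q = p div [:0, 1:]"
  have q: "poly p z = z * poly q z" for z using poly_div_X[OF p0] by (simp add: q_def)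
  have "[:0, 1:] * pcompose q [:0, -1:] = [:0, 1:] * q"
  proof (rule poly_ext)
    fix z show "poly ([:0, 1:] * pcompose q [:0, -1:]) z = poly ([:0, 1:] * q) z"
      using assms[of z] by (simp add: q poly_pcompose)
  qed
  then have "pcompose q [:0, -1:] = q" by (metis mult_cancel_left pCons_eq_0_iff one_neq_zero)
  then have "poly (pcompose q [:0, -1:]) z = poly q z" by simp
  then show ?thesis by (simp add: poly_pcompose q_def)
qed

lemma olver_B_step_odd:
  assumes "\<And>z. poly A (-z) = poly A z"
  shows "poly (olver_B_step \<mu> A) (-z) = - poly (olver_B_step \<mu> A) z"
proof -
  have d: "poly (pderiv A) (-z) = - poly (pderiv A) z" for z
    using pderiv_reflect[of A 1] assms by simp
  have "poly (poly_antideriv (monom 1 2 * A - smult (2*\<mu> + 1) (pderiv A div [:0, 1:]))) (-z) =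
     - 1 * poly (poly_antideriv (monom 1 2 * A - smult (2*\<mu> + 1) (pderiv A div [:0, 1:]))) z"
    by (rule antideriv_reflect) (simp add: poly_monom assms div_X_reflect[OF d])
  then show ?thesis by (simp add: olver_B_step_def d field_simps)
qed

lemma olver_A_step_even:
  assumes "\<And>z. poly B (-z) = - poly B z"
  shows "poly (olver_A_step \<mu> B) (-z) = poly (olver_A_step \<mu> B) z"
proof -
  have "poly (pderiv B) (-z) = poly (pderiv B) z"
    using pderiv_reflect[of B "-1"] assms by simp
  moreover have "poly (poly_antideriv (monom 1 2 * B)) (-z) =
     - (-1) * poly (poly_antideriv (monom 1 2 * B)) z"
    by (rule antideriv_reflect) (simp add: poly_monom assms)
  ultimately show ?thesis by (simp add: olver_A_step_def Let_def div_X_reflect[OF assms])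
qed

lemma olver_A_even: "poly (olver_A \<mu> s) (-z) = poly (olver_A \<mu> s) z"
  by (induction s arbitrary: z) (simp_all add: olver_A_step_even olver_B_step_odd)

lemma olver_B_odd: "poly (olver_B \<mu> s) (-z) = - poly (olver_B \<mu> s) z"
  by (simp add: olver_B_def olver_B_step_odd olver_A_even)

lemma olver_recursion_olver: "olver_recursion \<mu> (olver_A \<mu>) (olver_B \<mu>)"
proof -
  have "\<exists>I. ((\<lambda>t. t\<^sup>2 * poly (olver_A \<mu> s) t - (2*\<mu> + 1) / t * poly (pderiv (olver_A \<mu> s)) t)
              has_contour_integral I) (linepath 0 z) \<and>
            2 * poly (olver_B \<mu> s) z = - poly (pderiv (olver_A \<mu> s)) z + I" for s z
  proof -
    define P where "P = monom 1 2 * olver_A \<mu> s -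
      smult (2*\<mu> + 1) (pderiv (olver_A \<mu> s) div [:0, 1:])"
    have "poly (pderiv (olver_A \<mu> s)) 0 = 0"
      using pderiv_reflect[of "olver_A \<mu> s" 1 0] olver_A_even by (simp add: eq_neg_iff_add_eq_0)
    note q = poly_div_X[OF this]
    have 1: "(poly P has_contour_integral poly (poly_antideriv P) z) (linepath 0 z)"
      using contour_integral_primitive[of UNIV "poly (poly_antideriv P)" "poly P" "linepath 0 z"]
      using poly_DERIV[of "poly_antideriv P"]
      by (simp add: pderiv_poly_antideriv poly_antideriv_0)
    have 2: "poly P t =
        t\<^sup>2 * poly (olver_A \<mu> s) t - (2*\<mu> + 1) / t * poly (pderiv (olver_A \<mu> s)) t"
      if "t \<noteq> 0" for t
      using that by (simp add: P_def poly_monom q)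
    have "((\<lambda>t. t\<^sup>2 * poly (olver_A \<mu> s) t - (2*\<mu> + 1) / t * poly (pderiv (olver_A \<mu> s)) t)
              has_contour_integral poly (poly_antideriv P) z) (linepath 0 z)"
    proof (cases "z = 0")
      case True
      then show ?thesis by (simp add: poly_antideriv_0)
    next
      case False
      show ?thesis
        unfolding has_contour_integral_linepath
      proof (rule has_integral_spike_finite[of "{0}"])
        show "((\<lambda>x. poly P (linepath 0 z x) * (z - 0)) has_integral poly (poly_antideriv P) z) {0..1}"
          using 1 by (simp add: has_contour_integral_linepath)
        fix x :: real assume "x \<in> {0..1} - {0}"
        then have "linepath 0 z x \<noteq> 0" using False by (simp add: linepath_def)
        from 2[OF this] show "((linepath 0 z x)\<^sup>2 * poly (olver_A \<mu> s) (linepath 0 z x) -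
            (2*\<mu> + 1) / linepath 0 z x * poly (pderiv (olver_A \<mu> s)) (linepath 0 z x)) * (z - 0)
           = poly P (linepath 0 z x) * (z - 0)" by simp
      qed simp
    qed
    then show ?thesis
      by (intro exI[of _ "poly (poly_antideriv P) z"]) (simp add: olver_B_def olver_B_step_def P_def)
  qed
  moreover have "\<exists>G. (\<forall>z. (G has_field_derivative z\<^sup>2 * poly (olver_B \<mu> s) z) (at z)) \<and>
              (\<forall>z. z \<noteq> 0 \<longrightarrow> 2 * poly (olver_A \<mu> (Suc s)) z =
                 (2*\<mu> + 1) / z * poly (olver_B \<mu> s) z - poly (pderiv (olver_B \<mu> s)) z + G z)" for s
  proof -
    define J where "J = poly_antideriv (monom 1 2 * olver_B \<mu> s)"
    define P where "P = smult (1/2)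
     (smult (2*\<mu> + 1) (olver_B \<mu> s div [:0, 1:]) - pderiv (olver_B \<mu> s) + J)"
    have A: "olver_A \<mu> (Suc s) = P - [:poly P 0:]"
      by (simp add: olver_A_step_def Let_def P_def J_def olver_B_def)
    have "poly (olver_B \<mu> s) 0 = 0" using olver_B_odd[of \<mu> s 0] by simp
    note q = poly_div_X[OF this]
    have "(poly (J - [:2 * poly P 0:]) has_field_derivative z\<^sup>2 * poly (olver_B \<mu> s) z) (at z)" for z
      using poly_DERIV[of "J - [:2 * poly P 0:]" z]
      by (simp add: J_def pderiv_poly_antideriv pderiv_diff pderiv_pCons poly_monom del: poly_diff)
    moreover have "2 * poly (olver_A \<mu> (Suc s)) z = (2*\<mu> + 1) / z * poly (olver_B \<mu> s) z -
        poly (pderiv (olver_B \<mu> s)) z + poly (J - [:2 * poly P 0:]) z" if "z \<noteq> 0" for z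
      unfolding A using that by (simp add: P_def q field_simps)
    ultimately show ?thesis by blast
  qed
  moreover have "poly (olver_A \<mu> s) 0 = 0" if "s \<ge> 1" for s
    using that by (cases s) (simp_all add: olver_A_step_def Let_def)
  ultimately show ?thesis
    unfolding olver_recursion_def by (simp add: olver_A_even olver_B_odd del: olver_A.simps(2))
qed

theorem olver_recursion_iff:
  "olver_recursion \<mu> A B \<longleftrightarrow> A = olver_A \<mu> \<and> B = olver_B \<mu>"
proof
  assume AB: "olver_recursion \<mu> A B"
  note C = olver_recursion_olver[of \<mu>]
  have B: "B s = olver_B \<mu> s" if As: "A s = olver_A \<mu> s" for s
  proof (rule poly_ext)
    fix z
    let ?f = "\<lambda>t. t\<^sup>2 * poly (A s) t - (2*\<mu> + 1) / t * poly (pderiv (A s)) t"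
    obtain I where I: "(?f has_contour_integral I) (linepath 0 z)"
      "2 * poly (B s) z = - poly (pderiv (A s)) z + I"
      using AB unfolding olver_recursion_def by blast
    obtain I' where I': "(?f has_contour_integral I') (linepath 0 z)"
      "2 * poly (olver_B \<mu> s) z = - poly (pderiv (A s)) z + I'"
      using C unfolding olver_recursion_def As by blast
    have "I = I'" using I(1) I'(1) has_contour_integral_unique by blast
    then have "2 * poly (B s) z = 2 * poly (olver_B \<mu> s) z" using I(2) I'(2) by simp
    then show "poly (B s) z = poly (olver_B \<mu> s) z" by simp
  qed
  have A: "A s = olver_A \<mu> s" for s
  proof (induction s)
    case 0
    then show ?case using AB by (simp add: olver_recursion_def)
  next
    case (Suc s)
    note Bs = B[OF Suc]
    obtain G where G: "\<And>z. (G has_field_derivative z\<^sup>2 * poly (B s) z) (at z)"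
      "\<And>z. z \<noteq> 0 \<Longrightarrow> 2 * poly (A (Suc s)) z =
         (2*\<mu> + 1) / z * poly (B s) z - poly (pderiv (B s)) z + G z"
      using AB unfolding olver_recursion_def by blast
    obtain H where H: "\<And>z. (H has_field_derivative z\<^sup>2 * poly (B s) z) (at z)"
      "\<And>z. z \<noteq> 0 \<Longrightarrow> 2 * poly (olver_A \<mu> (Suc s)) z =
         (2*\<mu> + 1) / z * poly (B s) z - poly (pderiv (B s)) z + H z"
      using C unfolding olver_recursion_def Bs by blast
    have "((\<lambda>z. G z - H z) has_field_derivative 0) (at z)" for z
      using DERIV_diff[OF G(1)[of z] H(1)[of z]] by simp
    then obtain c where c: "\<And>z. G z - H z = c"
      using has_field_derivative_zero_constant[of UNIV "\<lambda>z. G z - H z"] by auto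
    define D where "D = smult 2 (A (Suc s) - olver_A \<mu> (Suc s)) - [:c:]"
    have "poly D z = 0" if "z \<noteq> 0" for z
      using c[of z]
      by (simp add: D_def right_diff_distrib G(2)[OF that] H(2)[OF that] del: olver_A.simps(2))
    then have "UNIV - {0} \<subseteq> {z. poly D z = 0}" by blast
    moreover have "infinite (UNIV - {0 :: complex})"
      using infinite_UNIV_char_0 by simp
    ultimately have "D = 0" using poly_roots_finite finite_subset by metis
    moreover have "poly (A (Suc s)) 0 = 0" "poly (olver_A \<mu> (Suc s)) 0 = 0"
      using AB C unfolding olver_recursion_def by (simp_all del: olver_A.simps(2))
    then have "poly D 0 = - c" by (simp add: D_def del: olver_A.simps(2))
    ultimately have "smult 2 (A (Suc s) - olver_A \<mu> (Suc s)) = 0" by (simp add: D_def)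
    then show ?case by (simp del: olver_A.simps(2))
  qed
  show "A = olver_A \<mu> \<and> B = olver_B \<mu>" using A B by blast
qed (auto simp: olver_recursion_olver)


section \<open>Temme's polynomials\<close>

text \<open>
  At the removable singularity \<open>s = 0\<close> the functions are given their limits \<open>0\<close> and \<open>1\<close>.
\<close>

definition temme_phi :: "complex \<Rightarrow> complex" where
  "temme_phi s = (if s = 0 then 0 else 1/s - 1/(exp s - 1) - 1/2)"

definition temme_base :: "complex \<Rightarrow> complex" where
  "temme_base s = (if s = 0 then 1 else (s/2) / sinh (s/2))"

text \<open>
  Near \<open>s = 0\<close> the base is close to \<open>1\<close>, so the principal power is the branch with value \<open>1\<close>
  at \<open>s = 0\<close>; only the germ at \<open>0\<close> matters for the Maclaurin coefficients.
\<close>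

definition temme_F :: "complex \<Rightarrow> complex \<Rightarrow> complex \<Rightarrow> complex" where
  "temme_F b s z = exp (z\<^sup>2 * temme_phi s) * temme_base s powr b"

text \<open>\<open>temme_c b n k z\<close> is \<open>c\<^sub>k\<^sup>(\<^sup>n\<^sup>)(z)\<close>.\<close>

primrec temme_c :: "complex \<Rightarrow> nat \<Rightarrow> nat \<Rightarrow> complex \<Rightarrow> complex" where
  "temme_c b 0 k z = fps_nth (fps_expansion (\<lambda>s. temme_F b s z) 0) k"
| "temme_c b (Suc n) k z =
     4 * (z\<^sup>2 * temme_c b n (k + 2) z + (1 - b + of_nat k) * temme_c b n (k + 1) z)"

definition temme_a :: "complex \<Rightarrow> nat \<Rightarrow> complex \<Rightarrow> complex" where
  "temme_a b n z = temme_c b n 0 z"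

definition temme_b :: "complex \<Rightarrow> nat \<Rightarrow> complex \<Rightarrow> complex" where
  "temme_b b n z = - 2 * z * temme_c b n 1 z"

lemma analytic_temme_phi: "temme_phi analytic_on {0}"
proof -
  define N :: "complex fps" where
    "N = fps_exp 1 - 1 - fps_X - fps_const (1/2) * (fps_X * (fps_exp 1 - 1))"
  define D :: "complex fps" where "D = fps_X * (fps_exp 1 - 1)"
  have N: "(\<lambda>s. exp s - 1 - s - 1/2 * (s * (exp s - 1))) has_fps_expansion N"
    unfolding N_def by (intro fps_expansion_intros)
  have D: "(\<lambda>s. s * (exp s - 1)) has_fps_expansion D"
    unfolding D_def by (intro fps_expansion_intros)
  have D2: "fps_nth D 2 = 1" by (simp add: D_def numeral_2_eq_2)
  have sD: "subdegree D = 2"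
  proof (rule subdegreeI)
    fix i :: nat assume "i < 2"
    then have "i = 0 \<or> i = 1" by auto
    then show "fps_nth D i = 0" by (auto simp: D_def)
  qed (use D2 in simp)
  have N3: "fps_nth N i = 0" if "i < 3" for i
  proof -
    have "i = 0 \<or> i = 1 \<or> i = 2" using that by auto
    then show ?thesis by (auto simp: N_def numeral_2_eq_2)
  qed
  have "N \<noteq> 0"
  proof
    assume "N = 0"
    then have "fps_nth N 3 = 0" by simp
    then show False by (simp add: N_def numeral_3_eq_3 numeral_2_eq_2)
  qed
  then have "subdegree D \<le> subdegree N" using N3 sD by (intro subdegree_geI) auto
  moreover have "D \<noteq> 0" using D2 by auto
  ultimately have "(\<lambda>s. if s = 0 then 0 else
      (exp s - 1 - s - 1/2 * (s * (exp s - 1))) / (s * (exp s - 1))) has_fps_expansion N / D"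
    using N3[of 2] sD by (intro has_fps_expansion_divide N D) auto
  then have an: "(\<lambda>s. if s = 0 then 0 else
      (exp s - 1 - s - 1/2 * (s * (exp s - 1))) / (s * (exp s - 1))) analytic_on {0}"
    by (rule has_fps_expansion_imp_analytic_0)
  have "eventually (\<lambda>s::complex. s \<in> ball 0 1) (nhds 0)"
    by (intro eventually_nhds_in_open) auto
  then have "eventually (\<lambda>s. (if s = 0 then 0 else
      (exp s - 1 - s - 1/2 * (s * (exp s - 1))) / (s * (exp s - 1))) = temme_phi s) (nhds 0)"
  proof eventually_elim
    case (elim s)
    have "exp s \<noteq> 1" if "s \<noteq> 0"
    proof
      assume "exp s = 1"
      moreover have "norm s < pi" using elim pi_gt3 by simp
      then have "\<bar>Im s\<bar> < pi" using abs_Im_le_cmod[of s] by linarith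
      ultimately show False using that
        using Ln_exp[of s] by (simp add: abs_less_iff)
    qed
    then show ?case by (auto simp: temme_phi_def divide_simps)
  qed
  from analytic_at_cong[OF this refl] an show ?thesis by simp
qed

lemma analytic_temme_base: "temme_base analytic_on {0}"
proof -
  define N :: "complex fps" where "N = fps_X"
  define D :: "complex fps" where "D = fps_exp (1/2) - fps_exp (-1/2)"
  have N: "(\<lambda>s. s) has_fps_expansion N"
    unfolding N_def by (intro fps_expansion_intros)
  have D: "(\<lambda>s. exp (1/2 * s) - exp (-1/2 * s)) has_fps_expansion D"
    unfolding D_def by (intro fps_expansion_intros)
  have D1: "fps_nth D 0 = 0" "fps_nth D 1 = 1" by (simp_all add: D_def)
  have sD: "subdegree D = 1" using D1 by (intro subdegreeI) auto
  have "D \<noteq> 0" using D1 by auto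
  then have "(\<lambda>s. if s = 0 then 1 else s / (exp (1/2 * s) - exp (-1/2 * s)))
      has_fps_expansion N / D"
    using sD D1 by (intro has_fps_expansion_divide N D) (auto simp: N_def)
  then have "(\<lambda>s. if s = 0 then 1 else s / (exp (1/2 * s) - exp (-1/2 * s))) analytic_on {0}"
    by (rule has_fps_expansion_imp_analytic_0)
  moreover have "(\<lambda>s. if s = 0 then 1 else s / (exp (1/2 * s) - exp (-1/2 * s))) = temme_base"
    by (auto simp: fun_eq_iff temme_base_def sinh_field_def)
  ultimately show ?thesis by simp
qed

theorem temme_F_has_fps_expansion:
  "(\<lambda>s. temme_F b s z) has_fps_expansion Abs_fps (\<lambda>k. temme_c b 0 k z)"
proof -
  have "(\<lambda>s. temme_F b s z) analytic_on {0}"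
    unfolding temme_F_def
    by (intro analytic_intros analytic_temme_phi analytic_temme_base) (auto simp: temme_base_def)
  then show ?thesis
    using analytic_at_imp_has_fps_expansion_0 by (simp add: fps_nth_inverse)
qed

end

theory Submission
  imports Defs
begin

text \<open>
  Put \<open>x = z\<^sup>2\<close> and \<open>g(s) = (s/2) / sinh (s/2)\<close>. All Temme coefficients \<open>c\<^sub>k\<^sup>(\<^sup>n\<^sup>)\<close> are polynomials in
  \<open>x\<close>, and the theorem comes down to one differential recurrence that holds at every level \<open>n\<close>:
  with \<open>c\<^sub>k = c\<^sub>k\<^sup>(\<^sup>n\<^sup>)\<close> and primes for \<open>d/dx\<close>,
  \<open>4 x c\<^sub>k'' + 4 b c\<^sub>k' - x c\<^sub>k = 4 (k+1) c\<^sub>k\<^sub>+\<^sub>1 + 8 x c\<^sub>k\<^sub>+\<^sub>1'\<close> for all \<open>k\<close> (\<open>diff_rec\<close>).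

  For \<open>n = 0\<close> it is a partial differential equation for the generating function
  \<open>F = exp (x \<phi>) g^b\<close>, namely \<open>4 x F\<^sub>x\<^sub>x + 4 b F\<^sub>x - x F = 4 F\<^sub>s + 8 x F\<^sub>x / s\<close>. Since
  \<open>F\<^sub>x = \<phi> F\<close> and \<open>F\<^sub>s = (x \<phi>' + b g'/g) F\<close>, comparing the coefficients of \<open>b\<close> and of \<open>x\<close> shows that
  it amounts to \<open>g' = \<phi> g\<close> (\<open>base_fps_deriv\<close>) and to the Riccati equation
  \<open>4 \<phi>' = 4 \<phi>\<^sup>2 - 1 - 8 \<phi>/s\<close> (\<open>Phi_fps_riccati\<close>), both of which hold because
  \<open>\<phi>(s) = 1/s - coth (s/2) / 2\<close>. Temme's recursion \<open>c\<^sup>(\<^sup>n\<^sup>) \<mapsto> c\<^sup>(\<^sup>n\<^sup>+\<^sup>1\<^sup>)\<close> preserves the recurrence by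
  direct computation (\<open>diff_rec_step\<close>).

  On the other side, with \<open>\<mu> = b - 1\<close>, Olver's polynomials with parameter \<open>-\<mu>\<close> turn out to be
  \<open>B\<^sub>n = -2 z c\<^sub>1\<^sup>(\<^sup>n\<^sup>)\<close> and \<open>A\<^sub>n\<^sub>+\<^sub>1 = 4 z\<^sup>2 c\<^sub>2\<^sup>(\<^sup>n\<^sup>)\<close>. The second formula is forced by the first: one wants
  \<open>A\<^sub>n\<^sub>+\<^sub>1 + 2 \<mu> B\<^sub>n / z = c\<^sub>0\<^sup>(\<^sup>n\<^sup>+\<^sup>1\<^sup>) = 4 (z\<^sup>2 c\<^sub>2\<^sup>(\<^sup>n\<^sup>) + (1-b) c\<^sub>1\<^sup>(\<^sup>n\<^sup>))\<close>. When differentiated and rewritten in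
  \<open>x\<close>, the step from \<open>B\<^sub>n\<close> to \<open>A\<^sub>n\<^sub>+\<^sub>1\<close> is the recurrence at level \<open>n\<close> with \<open>k = 1\<close>, and the step from
  \<open>A\<^sub>n\<^sub>+\<^sub>1\<close> to \<open>B\<^sub>n\<^sub>+\<^sub>1\<close> is the recurrence at level \<open>n\<close> with \<open>k = 2\<close>; the start \<open>A\<^sub>0 = 1\<close> to \<open>B\<^sub>0\<close> is level \<open>0\<close>
  with \<open>k = 0\<close>. The constants of integration agree because \<open>z\<^sup>2 c\<^sub>2\<^sup>(\<^sup>n\<^sup>)\<close> vanishes at \<open>0\<close>.
\<close>

section \<open>Maclaurin series of the two factors\<close>

definition Phi_fps :: "complex fps" where
  "Phi_fps = fps_expansion temme_phi 0"

definition base_fps :: "complex fps" where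
  "base_fps = fps_expansion temme_base 0"

definition base_powr_fps :: "complex \<Rightarrow> complex fps" where
  "base_powr_fps b = fps_expansion (\<lambda>s. temme_base s powr b) 0"

lemma has_fps_Phi: "temme_phi has_fps_expansion Phi_fps"
  unfolding Phi_fps_def by (rule analytic_at_imp_has_fps_expansion_0) (rule analytic_temme_phi)

lemma has_fps_base: "temme_base has_fps_expansion base_fps"
  unfolding base_fps_def by (rule analytic_at_imp_has_fps_expansion_0) (rule analytic_temme_base)

lemma has_fps_base_powr: "(\<lambda>s. temme_base s powr b) has_fps_expansion base_powr_fps b"
  unfolding base_powr_fps_def
  by (intro analytic_at_imp_has_fps_expansion_0 analytic_intros analytic_temme_base)
     (simp add: temme_base_def)

lemma Phi_fps_0: "fps_nth Phi_fps 0 = 0"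
  using has_fps_expansion_imp_0_eq_fps_nth_0[OF has_fps_Phi] by (simp add: temme_phi_def)

lemma base_fps_0: "fps_nth base_fps 0 = 1"
  using has_fps_expansion_imp_0_eq_fps_nth_0[OF has_fps_base] by (simp add: temme_base_def)

lemma base_powr_fps_0: "fps_nth (base_powr_fps b) 0 = 1"
  using has_fps_expansion_imp_0_eq_fps_nth_0[OF has_fps_base_powr, of b]
  by (simp add: temme_base_def)

lemma exp_neq_1_near_0:
  "eventually (\<lambda>s::complex. s \<noteq> 0 \<longrightarrow> exp s \<noteq> 1) (nhds 0)"
proof -
  have "eventually (\<lambda>s::complex. s \<in> ball 0 1) (nhds 0)"
    by (intro eventually_nhds_in_open) auto
  then show ?thesis
  proof eventually_elim
    case (elim s)
    have "\<bar>Im s\<bar> < pi" using elim pi_gt3 abs_Im_le_cmod[of s] by simp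
    then have "Ln (exp s) = s" by (intro Ln_exp) (simp_all add: abs_less_iff)
    then show ?case by auto
  qed
qed

text \<open>
  This determines the series of \<open>\<phi>\<close> without a division: it is the definition of \<open>\<phi>\<close> with the
  denominators \<open>s (e\<^sup>s - 1)\<close> and \<open>2\<close> cleared. The next lemma does the same for the base.
\<close>

lemma Phi_fps_eq:
  defines "W \<equiv> fps_exp 1 - 1 :: complex fps"
  shows "2 * (fps_X * W * Phi_fps) = 2 * W - 2 * fps_X - fps_X * W"
proof (rule fps_expansion_unique_complex)
  show "(\<lambda>s. 2 * (s * (exp s - 1) * temme_phi s)) has_fps_expansion 2 * (fps_X * W * Phi_fps)"
    unfolding W_def by (intro fps_expansion_intros has_fps_Phi)
  have "(\<lambda>s. 2 * (exp s - 1) - 2 * s - s * (exp s - 1)) has_fps_expansion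
          2 * W - 2 * fps_X - fps_X * W"
    unfolding W_def by (intro fps_expansion_intros)
  moreover have "eventually (\<lambda>s. 2 * (exp s - 1) - 2 * s - s * (exp s - 1)
      = 2 * (s * (exp s - 1) * temme_phi s)) (nhds 0)"
    using exp_neq_1_near_0
    by eventually_elim (auto simp: temme_phi_def divide_simps algebra_simps)
  ultimately show "(\<lambda>s. 2 * (s * (exp s - 1) * temme_phi s)) has_fps_expansion
      2 * W - 2 * fps_X - fps_X * W"
    using has_fps_expansion_cong[OF _ refl] by force
qed

lemma base_fps_eq:
  "base_fps * (fps_exp (1/2) - fps_exp (-1/2)) = fps_X"
proof (rule fps_expansion_unique_complex)
  show "(\<lambda>s. temme_base s * (exp (1/2 * s) - exp (-1/2 * s))) has_fps_expansion
      base_fps * (fps_exp (1/2) - fps_exp (-1/2))"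
    by (intro fps_expansion_intros has_fps_base)
  have "eventually (\<lambda>s. s = temme_base s * (exp (1/2 * s) - exp (-1/2 * s))) (nhds 0)"
    using exp_neq_1_near_0
  proof eventually_elim
    case (elim s)
    have "exp (1/2 * s) = exp s * exp (-1/2 * s)"
      by (simp add: exp_add[symmetric])
    then have "s \<noteq> 0 \<Longrightarrow> exp (1/2 * s) - exp (-1/2 * s) \<noteq> 0" using elim by auto
    then show ?case by (auto simp: temme_base_def sinh_field_def)
  qed
  from has_fps_expansion_cong[OF this refl]
  show "(\<lambda>s. temme_base s * (exp (1/2 * s) - exp (-1/2 * s))) has_fps_expansion fps_X"
    using has_fps_expansion_fps_X by (rule iffD1)
qed

lemma fps_exp_1_neq_1: "fps_exp 1 - 1 \<noteq> (0 :: complex fps)"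
proof
  assume "fps_exp 1 - 1 = (0 :: complex fps)"
  then have "fps_nth (fps_exp 1 - 1) 1 = (0 :: complex)" by simp
  then show False by simp
qed

text \<open>
  Differentiating the algebraic equation for \<open>\<phi>\<close> and using \<open>W' = W + 1\<close> for \<open>W = e\<^sup>s - 1\<close> expresses \<open>\<phi>'\<close>
  rationally in \<open>s\<close>, \<open>W\<close> and \<open>\<phi>\<close>; elimination of \<open>W\<close> leaves the Riccati equation inherited from
  \<open>coth' = 1 - coth\<^sup>2\<close>.
\<close>

lemma Phi_fps_riccati:
  "4 * fps_X * fps_deriv Phi_fps + 8 * Phi_fps = 4 * fps_X * Phi_fps\<^sup>2 - fps_X"
proof -
  define W where "W = (fps_exp 1 - 1 :: complex fps)"
  define X where "X = (fps_X :: complex fps)"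
  have W': "fps_deriv W = W + 1" by (simp add: W_def)
  have W0: "W \<noteq> 0" and X0: "X \<noteq> 0" by (simp_all add: W_def X_def fps_exp_1_neq_1)
  have 1: "2 * (X * W * Phi_fps) = 2 * W - 2 * X - X * W"
    unfolding W_def X_def by (rule Phi_fps_eq)
  from arg_cong[OF 1, of fps_deriv]
  have 2: "2 * (W * Phi_fps + X * (W + 1) * Phi_fps + X * W * fps_deriv Phi_fps) =
      2 * (W + 1) - 2 - W - X * (W + 1)"
    by (simp add: W' X_def algebra_simps)
  have "(X * W)\<^sup>2 * (4 * X * fps_deriv Phi_fps + 8 * Phi_fps - (4 * X * Phi_fps\<^sup>2 - X)) = 0"
    using 1 2 by algebra
  then show ?thesis using W0 X0 by (simp add: X_def)
qed

text \<open>
  The logarithmic derivative of \<open>(s/2) / sinh (s/2)\<close> is \<open>1/s - coth (s/2) / 2 = \<phi>(s)\<close>. The proof works in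
  the ring generated by \<open>s\<close> and \<open>H = e\<^sup>s\<^sup>/\<^sup>2\<close>, \<open>K = e\<^sup>-\<^sup>s\<^sup>/\<^sup>2\<close>, in which \<open>e\<^sup>s = H\<^sup>2\<close> and \<open>H K = 1\<close>.
\<close>

lemma base_fps_deriv: "fps_deriv base_fps = Phi_fps * base_fps"
proof -
  define X where "X = (fps_X :: complex fps)"
  define H where "H = (fps_exp (1/2) :: complex fps)"
  define K where "K = (fps_exp (-1/2) :: complex fps)"
  have HK: "H * K = 1" by (simp add: H_def K_def fps_exp_add_mult[symmetric])
  have HH: "H * H = fps_exp 1" by (simp add: H_def fps_exp_add_mult[symmetric])
  have H': "2 * fps_deriv H = H" "2 * fps_deriv K = - K"
    by (rule fps_ext; simp add: H_def K_def numeral_fps_const)+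
  have 1: "2 * (X * (H * H - 1) * Phi_fps) = 2 * (H * H - 1) - 2 * X - X * (H * H - 1)"
    unfolding X_def HH by (rule Phi_fps_eq)
  have 2: "base_fps * (H - K) = X"
    unfolding H_def K_def X_def by (rule base_fps_eq)
  from arg_cong[OF 2, of fps_deriv]
  have "fps_deriv base_fps * (H - K) + base_fps * (fps_deriv H - fps_deriv K) = 1"
    by (simp add: X_def algebra_simps)
  then have 3: "2 * fps_deriv base_fps * (H - K) + base_fps * (H + K) = 2"
    using H' by algebra
  have "2 * X * (H * H - 1) * (fps_deriv base_fps - Phi_fps * base_fps) = 0"
    using 1 2 3 HK by algebra
  then show ?thesis using fps_exp_1_neq_1 by (simp add: X_def HH)
qed

text \<open>
  The power rule \<open>g (g^b)' = b g' g^b\<close>, valid near \<open>0\<close> where \<open>g\<close> stays off the branch cut, is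
  transferred to series; this form involves no exponent other than \<open>b\<close>, and \<open>g\<close> cancels.
\<close>

lemma base_powr_fps_deriv:
  "fps_deriv (base_powr_fps b) = fps_const b * Phi_fps * base_powr_fps b"
proof -
  have "base_fps * fps_deriv (base_powr_fps b) = fps_const b * fps_deriv base_fps * base_powr_fps b"
  proof (rule fps_expansion_unique_complex)
    show "(\<lambda>s. temme_base s * deriv (\<lambda>s. temme_base s powr b) s) has_fps_expansion
        base_fps * fps_deriv (base_powr_fps b)"
      by (rule has_fps_expansion_mult[OF has_fps_base has_fps_expansion_deriv[OF has_fps_base_powr]])
    have *: "(\<lambda>s. b * deriv temme_base s * temme_base s powr b) has_fps_expansion
        fps_const b * fps_deriv base_fps * base_powr_fps b"
      by (intro has_fps_expansion_mult has_fps_expansion_cmult_left has_fps_expansion_deriv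
          has_fps_base has_fps_base_powr)
    obtain S where S: "open S" "0 \<in> S" "temme_base holomorphic_on S"
      using analytic_temme_base analytic_at by blast
    then have "eventually (\<lambda>s. s \<in> S) (nhds 0)"
      by (intro eventually_nhds_in_open)
    moreover have "isCont temme_base 0"
      using analytic_temme_base analytic_at_imp_isCont by blast
    then have "eventually (\<lambda>s. temme_base s \<in> - \<real>\<^sub>\<le>\<^sub>0) (nhds 0)"
      using closed_nonpos_Reals_complex
      by (intro eventually_compose_filterlim[OF eventually_nhds_in_open, of _ "temme_base 0"])
         (simp_all add: isCont_def tendsto_at_iff_tendsto_nhds open_Compl, simp add: temme_base_def)
    ultimately have "eventually (\<lambda>s. b * deriv temme_base s * temme_base s powr b =
        temme_base s * deriv (\<lambda>s. temme_base s powr b) s) (nhds 0)"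
    proof eventually_elim
      case (elim s)
      have "(temme_base has_field_derivative deriv temme_base s) (at s)"
        using holomorphic_derivI[OF S(3,1) elim(1)] .
      moreover have nz: "temme_base s \<notin> \<real>\<^sub>\<le>\<^sub>0" "temme_base s \<noteq> 0" using elim(2) by auto
      ultimately have "((\<lambda>s. temme_base s powr b) has_field_derivative
          b * temme_base s powr (b - 1) * deriv temme_base s) (at s)"
        by (auto intro!: derivative_eq_intros)
      then have "deriv (\<lambda>s. temme_base s powr b) s =
          b * temme_base s powr (b - 1) * deriv temme_base s" by (rule DERIV_imp_deriv)
      then show ?case using nz by (simp add: powr_diff)
    qed
    from has_fps_expansion_cong[OF this refl] *
    show "(\<lambda>s. temme_base s * deriv (\<lambda>s. temme_base s powr b) s) has_fps_expansion
        fps_const b * fps_deriv base_fps * base_powr_fps b" by simp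
  qed
  then have "base_fps * (fps_deriv (base_powr_fps b) - fps_const b * Phi_fps * base_powr_fps b) = 0"
    by (simp add: base_fps_deriv algebra_simps)
  moreover have "base_fps \<noteq> 0" using base_fps_0 by auto
  ultimately show ?thesis by simp
qed

section \<open>The coefficients as polynomials in the square of the variable\<close>

text \<open>
  The coefficient of \<open>s\<^sup>k\<close> in \<open>exp (x \<phi>) g^b = (\<Sum>j. x\<^sup>j \<phi>\<^sup>j g^b / j!)\<close>; the sum stops at \<open>j = k\<close> because
  \<open>\<phi>\<close> vanishes at \<open>0\<close>.
\<close>

definition temme_coeff_poly :: "complex \<Rightarrow> nat \<Rightarrow> complex poly" where
  "temme_coeff_poly b k =
     (\<Sum>j\<le>k. monom (fps_nth (Phi_fps ^ j * base_powr_fps b) k / fact j) j)"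

primrec temme_c_poly :: "complex \<Rightarrow> nat \<Rightarrow> nat \<Rightarrow> complex poly" where
  "temme_c_poly b 0 k = temme_coeff_poly b k"
| "temme_c_poly b (Suc n) k = smult 4 ([:0, 1:] * temme_c_poly b n (k + 2) +
     smult (1 - b + of_nat k) (temme_c_poly b n (k + 1)))"

lemma Phi_power_nth_eq_0: "i < j \<Longrightarrow> fps_nth (Phi_fps ^ j) i = 0"
  using startsby_zero_power_prefix[OF Phi_fps_0] by simp

lemma Phi_power_mult_nth_eq_0: "k < j \<Longrightarrow> fps_nth (Phi_fps ^ j * g) k = 0"
  by (simp add: fps_mult_nth Phi_power_nth_eq_0)

lemma coeff_temme_coeff_poly:
  "coeff (temme_coeff_poly b k) j = fps_nth (Phi_fps ^ j * base_powr_fps b) k / fact j"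
  by (auto simp: temme_coeff_poly_def coeff_sum Phi_power_mult_nth_eq_0 not_le)

lemma poly_temme_coeff_poly: "temme_c b 0 k z = poly (temme_coeff_poly b k) (z\<^sup>2)"
proof -
  let ?G = "base_powr_fps b"
  have "(\<lambda>s. exp (z\<^sup>2 * temme_phi s)) has_fps_expansion fps_compose (fps_exp (z\<^sup>2)) Phi_fps"
    using has_fps_expansion_compose[OF has_fps_expansion_exp[of "z\<^sup>2"] has_fps_Phi Phi_fps_0]
    by (simp add: o_def)
  then have "(\<lambda>s. temme_F b s z) has_fps_expansion fps_compose (fps_exp (z\<^sup>2)) Phi_fps * ?G"
    unfolding temme_F_def by (intro fps_expansion_intros has_fps_base_powr)
  from fps_expansion_unique_complex[OF temme_F_has_fps_expansion[of b z] this]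
  have "temme_c b 0 k z = fps_nth (fps_compose (fps_exp (z\<^sup>2)) Phi_fps * ?G) k"
    by (metis fps_nth_Abs_fps)
  also have "\<dots> = (\<Sum>i\<le>k. (\<Sum>j\<le>k. (z\<^sup>2) ^ j / fact j * fps_nth (Phi_fps ^ j) i) * fps_nth ?G (k - i))"
  proof -
    have "fps_nth (fps_compose (fps_exp (z\<^sup>2)) Phi_fps) i =
        (\<Sum>j\<le>k. (z\<^sup>2) ^ j / fact j * fps_nth (Phi_fps ^ j) i)" if "i \<le> k" for i
      unfolding fps_compose_nth atMost_atLeast0
      by (rule sum.mono_neutral_cong_left) (use that in \<open>auto simp: Phi_power_nth_eq_0\<close>)
    then show ?thesis by (simp add: fps_mult_nth atMost_atLeast0)
  qed
  also have "\<dots> = (\<Sum>j\<le>k. fps_nth (Phi_fps ^ j * ?G) k / fact j * (z\<^sup>2) ^ j)"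
    unfolding sum_distrib_right fps_mult_nth atMost_atLeast0 sum_divide_distrib
    by (subst sum.swap) (simp add: algebra_simps)
  also have "\<dots> = poly (temme_coeff_poly b k) (z\<^sup>2)"
    by (simp add: temme_coeff_poly_def poly_sum poly_monom)
  finally show ?thesis .
qed

lemma poly_temme_c_poly: "temme_c b n k z = poly (temme_c_poly b n k) (z\<^sup>2)"
proof (induction n arbitrary: k)
  case 0
  show ?case unfolding poly_temme_coeff_poly by simp
qed (simp add: algebra_simps)

section \<open>A differential recurrence\<close>

text \<open>
  In terms of the generating function \<open>F = (\<Sum>k. c\<^sub>k s\<^sup>k)\<close> this is the equation
  \<open>4 x F\<^sub>x\<^sub>x + 4 b F\<^sub>x - x F = 4 F\<^sub>s + 8 x (F - c\<^sub>0)\<^sub>x / s\<close>. In the variable \<open>z\<close> with \<open>x = z\<^sup>2\<close>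
  the operator on the left is \<open>d\<^sup>2/dz\<^sup>2 + (2b-1)/z d/dz - z\<^sup>2\<close>.
\<close>

definition diff_rec :: "complex \<Rightarrow> (nat \<Rightarrow> complex poly) \<Rightarrow> bool" where
  "diff_rec b c \<longleftrightarrow> (\<forall>k x.
     4 * x * poly (pderiv (pderiv (c k))) x + 4 * b * poly (pderiv (c k)) x - x * poly (c k) x =
     4 * (of_nat k + 1) * poly (c (k + 1)) x + 8 * x * poly (pderiv (c (k + 1))) x)"

text \<open>
  The recurrence at level \<open>0\<close>, read off for a single power of \<open>x\<close>: the equation for
  \<open>s (\<phi>\<^sup>j g^b)'\<close> obtained from the two differential equations above, at the coefficient of \<open>s\<^sup>k\<^sup>+\<^sup>1\<close>.
  For \<open>j = 0\<close> the truncated \<open>j - 1\<close> is harmless since that term carries the factor \<open>j\<close>.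
\<close>

lemma fps_Phi_power_base_powr_nth:
  fixes b :: complex and j :: nat
  defines "u \<equiv> \<lambda>j k. fps_nth (Phi_fps ^ j * base_powr_fps b) k"
  shows "4 * (of_nat k + 1) * u j (k + 1) + 8 * of_nat j * u j (k + 1) =
    4 * (of_nat j + b) * u (j + 1) k - of_nat j * u (j - 1) k"
proof -
  define P where "P = Phi_fps"
  define G where "G = base_powr_fps b"
  have "4 * fps_X * fps_deriv (P ^ j * G) + 8 * of_nat j * (P ^ j * G) =
      fps_X * (4 * (of_nat j + fps_const b) * (P ^ (j + 1) * G) - of_nat j * (P ^ (j - 1) * G))"
  proof (cases j)
    case 0
    then show ?thesis by (simp add: G_def P_def base_powr_fps_deriv algebra_simps)
  next
    case (Suc i)
    have R: "4 * fps_X * fps_deriv P + 8 * P = 4 * fps_X * P\<^sup>2 - fps_X"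
      unfolding P_def by (rule Phi_fps_riccati)
    have D: "fps_deriv (P ^ j * G) =
        of_nat j * P ^ i * fps_deriv P * G + P ^ j * (fps_const b * P * G)"
      by (simp add: Suc fps_deriv_power G_def P_def base_powr_fps_deriv algebra_simps
          fps_of_nat del: of_nat_Suc power_Suc)
    have "P ^ j = P ^ i * P" "P ^ (j + 1) = P ^ i * P * P" "j - 1 = i" using Suc by simp_all
    note pow = this
    \<comment> \<open>The identity is stated with free letters so that the symbolic power \<open>P\<^sup>i\<close> becomes an indeterminate.\<close>
    have "4 * X * (m * Q * P' * G + Q * P * (c * P * G)) + 8 * m * (Q * P * G) =
        X * (4 * (m + c) * (Q * P * P * G) - m * (Q * G))"
      if "4 * X * P' + 8 * P = 4 * X * P\<^sup>2 - X" for X m Q P P' G c :: "complex fps"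
      using that by algebra
    from this[OF R] show ?thesis
      unfolding pow D[unfolded pow] by blast
  qed
  moreover have "4 * (of_nat k + 1) * fps_nth A (k + 1) + 8 * of_nat j * fps_nth A (k + 1) =
      4 * (of_nat j + b) * fps_nth B k - of_nat j * fps_nth C k"
    if "4 * fps_X * fps_deriv A + 8 * of_nat j * A =
        fps_X * (4 * (of_nat j + fps_const b) * B - of_nat j * C)" for A B C :: "complex fps"
    using arg_cong[OF that, of "\<lambda>f. fps_nth f (Suc k)"]
    by (simp add: numeral_fps_const fps_of_nat[symmetric] mult.assoc del: fps_of_nat) (simp add: algebra_simps)
  ultimately show ?thesis
    unfolding u_def P_def G_def by blast
qed

lemma diff_rec_temme_coeff_poly: "diff_rec b (temme_coeff_poly b)"
  unfolding diff_rec_def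
proof (intro allI)
  fix k :: nat and x :: complex
  let ?c = "temme_coeff_poly b"
  have "smult 4 (pCons 0 (pderiv (pderiv (?c k)))) + smult (4 * b) (pderiv (?c k)) - pCons 0 (?c k) =
     smult (4 * (of_nat k + 1)) (?c (k + 1)) + smult 8 (pCons 0 (pderiv (?c (k + 1))))"
    (is "?L = ?R")
  proof (rule poly_eqI)
    fix j
    show "coeff ?L j = coeff ?R j"
    proof (cases j)
      case 0
      then show ?thesis using fps_Phi_power_base_powr_nth[where k = k and b = b and j = 0]
        by (simp add: coeff_pderiv coeff_temme_coeff_poly)
    next
      case (Suc i)
      have "complex_of_nat (Suc i) \<noteq> 0" "complex_of_nat (Suc (Suc i)) \<noteq> 0"
        by (rule of_nat_neq_0)+
      then have "1 + complex_of_nat i \<noteq> 0" "2 + complex_of_nat i \<noteq> 0" by simp_all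
      with Suc show ?thesis using fps_Phi_power_base_powr_nth[where k = k and b = b and j = j]
        by (simp add: coeff_pderiv coeff_temme_coeff_poly divide_simps) (simp add: algebra_simps)
    qed
  qed
  from arg_cong[OF this, of "\<lambda>p. poly p x"]
  show "4 * x * poly (pderiv (pderiv (?c k))) x + 4 * b * poly (pderiv (?c k)) x - x * poly (?c k) x =
     4 * (of_nat k + 1) * poly (?c (k + 1)) x + 8 * x * poly (pderiv (?c (k + 1))) x"
    by (simp add: algebra_simps)
qed

text \<open>
  Write \<open>M\<close> for the operator on the left of the recurrence. Since \<open>M (x c) = x M c + 8 x c' + 4 b c\<close>,
  applying \<open>M\<close> to the new \<open>k\<close>-th polynomial involves only the old recurrence at \<open>k + 1\<close> and \<open>k + 2\<close>,
  and the remaining terms match those on the right.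
\<close>

lemma diff_rec_step:
  assumes "diff_rec b c"
  shows "diff_rec b (\<lambda>k. smult 4 ([:0, 1:] * c (k + 2) + smult (1 - b + of_nat k) (c (k + 1))))"
  unfolding diff_rec_def
proof (intro allI, goal_cases)
  case (1 k x)
  note H = assms[unfolded diff_rec_def, rule_format]
  have idx: "k + 1 + 1 = k + 2" "k + 2 + 1 = k + 3" "k + 1 + 2 = k + 3" by simp_all
  show ?case
    using H[of x "k + 1"] H[of x "k + 2"] unfolding idx
    by (simp add: pderiv_smult pderiv_add pderiv_mult pderiv_pCons del: One_nat_def) algebra
qed

lemma diff_rec_temme_c_poly: "diff_rec b (temme_c_poly b n)"
proof (induction n)
  case 0
  show ?case using diff_rec_temme_coeff_poly[of b] by (simp add: diff_rec_def)
next
  case (Suc n)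
  show ?case using diff_rec_step[OF Suc] by (simp add: diff_rec_def)
qed

section \<open>Olver's recursion in the square of the variable\<close>

abbreviation (input) sq :: "complex poly \<Rightarrow> complex poly" where
  "sq p \<equiv> pcompose p [:0, 0, 1:]"

lemma pderiv_sq: "pderiv (sq p) = [:0, 1:] * smult 2 (sq (pderiv p))"
  by (simp add: pderiv_pcompose pderiv_pCons mult.commute)

lemma poly_antideriv_eqI:
  assumes "pderiv q = p" "poly q 0 = 0"
  shows "poly_antideriv p = q"
proof -
  have "pderiv (poly_antideriv p - q) = 0" using assms by (simp add: pderiv_diff pderiv_poly_antideriv)
  then obtain k where k: "poly_antideriv p - q = [:k:]" using pderiv_iszero by blast
  have "poly (poly_antideriv p - q) 0 = 0" using assms by (simp add: poly_antideriv_0)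
  with k show ?thesis by simp
qed

lemma X_mult_div_X: "([:0, 1:] * p) div [:0, 1:] = (p :: complex poly)"
  by (rule nonzero_mult_div_cancel_left) simp

text \<open>
  A step of Olver's recursion is an identity between antiderivatives, so it may be checked after
  differentiation in \<open>z\<close>. For an even \<open>A(z\<^sup>2)\<close> and an odd \<open>z \<beta>(z\<^sup>2)\<close> both sides then depend on
  \<open>x = z\<^sup>2\<close> only, up to a factor \<open>z\<close> in the second step, and the division by \<open>z\<close> disappears.
\<close>

lemma olver_B_step_sq:
  assumes "\<And>x. 2 * poly \<beta> x + 4 * x * poly (pderiv \<beta>) x + 4 * x * poly (pderiv (pderiv A)) x +
    4 * (\<mu> + 1) * poly (pderiv A) x = x * poly A x"
  shows "olver_B_step \<mu> (sq A) = [:0, 1:] * sq \<beta>"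
proof -
  have "poly_antideriv (monom 1 2 * sq A - smult (2*\<mu> + 1) (smult 2 (sq (pderiv A)))) =
      smult 2 ([:0, 1:] * sq \<beta>) + pderiv (sq A)"
  proof (rule poly_antideriv_eqI, rule poly_ext)
    fix z
    show "poly (pderiv (smult 2 ([:0, 1:] * sq \<beta>) + pderiv (sq A))) z =
       poly (monom 1 2 * sq A - smult (2*\<mu> + 1) (smult 2 (sq (pderiv A)))) z"
      using assms[of "z\<^sup>2"]
      by (simp add: pderiv_sq pderiv_add pderiv_mult pderiv_smult pderiv_pCons poly_pcompose
          poly_monom power2_eq_square) algebra
  qed (simp add: pderiv_sq)
  then show ?thesis
    unfolding olver_B_step_def pderiv_sq[of A] X_mult_div_X by simp
qed

lemma olver_A_step_sq:
  assumes "\<And>x. 4 * poly (pderiv A) x + 4 * x * poly (pderiv (pderiv \<beta>)) x +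
    4 * (1 - \<mu>) * poly (pderiv \<beta>) x = x * poly \<beta> x"
  assumes "poly A 0 = 0"
  shows "olver_A_step \<mu> ([:0, 1:] * sq \<beta>) = sq A"
proof -
  let ?B = "[:0, 1:] * sq \<beta>"
  define q where "q = smult 2 (sq A) - smult (2*\<mu> + 1) (sq \<beta>) + pderiv ?B"
  have "poly_antideriv (monom 1 2 * ?B) = q - [:poly q 0:]"
  proof (rule poly_antideriv_eqI, rule poly_ext)
    fix z
    show "poly (pderiv (q - [:poly q 0:])) z = poly (monom 1 2 * ?B) z"
      using assms(1)[of "z\<^sup>2"]
      by (simp add: q_def pderiv_sq pderiv_add pderiv_diff pderiv_mult pderiv_smult pderiv_pCons
          poly_pcompose poly_monom power2_eq_square) algebra
  qed simp
  then have "olver_A_step \<mu> ?B = sq A - [:poly (sq A) 0:]"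
    unfolding olver_A_step_def X_mult_div_X Let_def
    by (simp add: q_def smult_diff_right smult_add_right)
  then show ?thesis using assms(2) by (simp add: poly_pcompose)
qed

section \<open>Olver's polynomials in terms of Temme's coefficients\<close>

text \<open>The required equation for \<open>\<beta> = -2 c\<^sub>1\<^sup>(\<^sup>n\<^sup>)\<close> is the differential recurrence at \<open>k = 1\<close>.\<close>

lemma olver_A_Suc_from_B:
  assumes "olver_B (1 - b) n = [:0, 1:] * sq (smult (-2) (temme_c_poly b n 1))"
  shows "olver_A (1 - b) (Suc n) = sq (smult 4 ([:0, 1:] * temme_c_poly b n 2))"
proof -
  have "olver_A (1 - b) (Suc n) = olver_A_step (1 - b) (olver_B (1 - b) n)"
    by (simp add: olver_B_def)
  also have "\<dots> = sq (smult 4 ([:0, 1:] * temme_c_poly b n 2))"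
    unfolding assms
  proof (rule olver_A_step_sq)
    fix x
    show "4 * poly (pderiv (smult 4 ([:0, 1:] * temme_c_poly b n 2))) x +
        4 * x * poly (pderiv (pderiv (smult (-2) (temme_c_poly b n 1)))) x +
        4 * (1 - (1 - b)) * poly (pderiv (smult (-2) (temme_c_poly b n 1))) x =
        x * poly (smult (-2) (temme_c_poly b n 1)) x"
      using diff_rec_temme_c_poly[of b n, unfolded diff_rec_def, rule_format, of x 1]
      by (simp add: pderiv_smult pderiv_add pderiv_mult pderiv_pCons pderiv_minus one_add_one
            del: One_nat_def) algebra
  qed simp
  finally show ?thesis .
qed

text \<open>
  The induction starts from \<open>c\<^sub>0\<^sup>(\<^sup>0\<^sup>) = A\<^sub>0 = 1\<close>, where the recurrence at \<open>k = 0\<close> is the required equation.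
  In the step \<open>c\<^sub>1\<^sup>(\<^sup>n\<^sup>+\<^sup>1\<^sup>)\<close> is expanded by Temme's recursion into \<open>c\<^sub>3\<^sup>(\<^sup>n\<^sup>)\<close> and \<open>c\<^sub>2\<^sup>(\<^sup>n\<^sup>)\<close>, and the equation
  between \<open>A\<^sub>n\<^sub>+\<^sub>1 = 4 x c\<^sub>2\<^sup>(\<^sup>n\<^sup>)\<close> and these is \<open>4 x\<close> times the recurrence at \<open>k = 2\<close>.
\<close>

lemma olver_B_eq:
  "olver_B (1 - b) n = [:0, 1:] * sq (smult (-2) (temme_c_poly b n 1))"
proof (induction n)
  case 0
  have c0: "temme_coeff_poly b 0 = 1"
    by (simp add: temme_coeff_poly_def base_powr_fps_0)
  have "olver_B_step (1 - b) (sq 1) = [:0, 1:] * sq (smult (-2) (temme_c_poly b 0 1))"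
  proof (rule olver_B_step_sq, goal_cases)
    case (1 x)
    show ?case
      using diff_rec_temme_c_poly[of b 0, unfolded diff_rec_def, rule_format, of x 0]
      by (simp add: pderiv_smult pderiv_minus c0) algebra
  qed
  then show ?case by (simp only: olver_B_def olver_A.simps pcompose_1)
next
  case (Suc n)
  let ?A = "smult 4 ([:0, 1:] * temme_c_poly b n 2)"
  have idx: "2 + 1 = (3 :: nat)" "1 + 2 = (3 :: nat)" "1 + 1 = (2 :: nat)" by simp_all
  have "olver_B_step (1 - b) (sq ?A) = [:0, 1:] * sq (smult (-2) (temme_c_poly b (Suc n) 1))"
  proof (rule olver_B_step_sq, goal_cases)
    case (1 x)
    show ?case
      unfolding temme_c_poly.simps idx
      using diff_rec_temme_c_poly[of b n, unfolded diff_rec_def, rule_format, of x 2, unfolded idx]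
      by (simp add: pderiv_smult pderiv_add pderiv_mult pderiv_pCons pderiv_minus del: One_nat_def)
        algebra
  qed
  then show ?case
    unfolding olver_B_def[of _ "Suc n"] olver_A_Suc_from_B[OF Suc] .
qed

theorem theorem9p1:
  fixes b :: complex and n :: nat
  shows "poly (olver_a b n) = temme_a b n \<and> poly (olver_b b n) = temme_b b n"
proof
  have mu: "- (b - 1) = 1 - b" by simp
  show "poly (olver_b b n) = temme_b b n"
  proof
    fix z
    have "poly (olver_b b n) z = z * (- 2 * poly (temme_c_poly b n 1) (z\<^sup>2))"
      unfolding olver_b_def Let_def mu olver_B_eq
      by (simp add: poly_pcompose power2_eq_square)
    then show "poly (olver_b b n) z = temme_b b n z"
      unfolding temme_b_def poly_temme_c_poly by simp
  qed
  show "poly (olver_a b n) = temme_a b n"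
  proof
    fix z
    have "poly (olver_a b n) z = poly (temme_c_poly b n 0) (z\<^sup>2)"
    proof (cases n)
      case 0
      then show ?thesis by (simp add: temme_coeff_poly_def base_powr_fps_0)
    next
      case (Suc m)
      have "olver_a b n = sq (smult 4 ([:0, 1:] * temme_c_poly b m 2)) +
          smult (2 * (b - 1)) (sq (smult (-2) (temme_c_poly b m 1)))"
        unfolding Suc olver_a.simps Let_def mu
        by (simp only: olver_A_Suc_from_B[OF olver_B_eq] olver_B_eq X_mult_div_X)
      then have "poly (olver_a b n) z = 4 * (z\<^sup>2 * poly (temme_c_poly b m 2) (z\<^sup>2)) +
          2 * (b - 1) * (- 2 * poly (temme_c_poly b m 1) (z\<^sup>2))"
        by (simp add: poly_pcompose power2_eq_square)
      also have "\<dots> = poly (temme_c_poly b n 0) (z\<^sup>2)"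
        by (simp add: Suc algebra_simps numeral_2_eq_2)
      finally show ?thesis .
    qed
    then show "poly (olver_a b n) z = temme_a b n z"
      by (simp only: temme_a_def poly_temme_c_poly)
  qed
qed

end
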